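(* For every H-group $P$, the center $Z(P)=\{g\in P\mid \mu(g,-)\simeq\mu(-,g)\}$ is a normal saturated sub-H-group of $P$.
   Context: An H-group $(P,\mu,\eta,c)$ is a pointed space $(P,p_0)$ with continuous pointed maps $\mu:P\times P\to P$, $\eta:P\to P$ and the constant map $c:P\to P$ at $p_0$ such that, via pointed homotopies, $\mu(1_P,c)\simeq\mu(c,1_P)\simeq 1_P$, $\mu(\eta,1_P)\simeq\mu(1_P,\eta)\simeq c$ and $\mu(\mu\times 1_P)\simeq\mu(1_P\times\mu)$. Write $g.h=\mu(g,h)$ and $g^{-1}=\eta(g)$. The maps $\mu(g,-),\mu(-,g):P\to P$ are $x\mapsto g.x$ and $x\mapsto x.g$; the homotopy between them in the definition of $Z(P)$ is free (not base-point preserving). An H-homomorphism between H-groups $(P,\mu,\eta,c)$ and $(Q,\mu_2,\eta_2,c_2)$ is a continuous map $\varphi:P\to Q$ with $\varphi\mu\simeq\mu_2(\varphi\times\varphi)$ and $\varphi\eta\simeq\eta_2\varphi$. A sub-H-group of $P$ is a pointed subspace $P'\ni p_0$ which is itself an H-group (with base point $p_0$) such that the inclusion $P'\to P$ is an H-homomorphism. A subset $A\subseteq P$ is saturated if it contains the path component in $P$ of each of its points. Write $g\,\widetilde{\in}\,A$ if there is a path in $P$ from $g$ to a point of $A$. A sub-H-group $P'$ is normal if $g.g'.g^{-1}\,\widetilde{\in}\,P'$ for all $g\in P$, $g'\in P'$. *)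

theory Defs
  imports "HOL-Analysis.Analysis"
begin

text \<open>A space is a value \<open>P :: 'a topology\<close>. A pointed homotopy is a homotopy all of
  whose stages send the base point to the base point.\<close>

definition pointed_homotopic ::
  "'a topology \<Rightarrow> 'a \<Rightarrow> 'b topology \<Rightarrow> 'b \<Rightarrow> ('a \<Rightarrow> 'b) \<Rightarrow> ('a \<Rightarrow> 'b) \<Rightarrow> bool" where
  "pointed_homotopic X x0 Y y0 f g \<longleftrightarrow> homotopic_with (\<lambda>h. h x0 = y0) X Y f g"

text \<open>The constant map \<open>c\<close> of an H-group \<open>(P, \<mu>, \<eta>, c)\<close> is determined by the base point and
  is therefore not a separate parameter: it is \<open>\<lambda>_. p0\<close>. The canonical homeomorphism between
  \<open>(P \<times> P) \<times> P\<close> and \<open>P \<times> (P \<times> P)\<close> is left implicit in the associativity clause.\<close>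

definition H_group :: "'a topology \<Rightarrow> 'a \<Rightarrow> ('a \<times> 'a \<Rightarrow> 'a) \<Rightarrow> ('a \<Rightarrow> 'a) \<Rightarrow> bool" where
  "H_group P p0 \<mu> \<eta> \<longleftrightarrow>
     p0 \<in> topspace P \<and>
     continuous_map (prod_topology P P) P \<mu> \<and> \<mu> (p0, p0) = p0 \<and>
     continuous_map P P \<eta> \<and> \<eta> p0 = p0 \<and>
     pointed_homotopic P p0 P p0 (\<lambda>x. \<mu> (x, p0)) (\<lambda>x. x) \<and>
     pointed_homotopic P p0 P p0 (\<lambda>x. \<mu> (p0, x)) (\<lambda>x. x) \<and>
     pointed_homotopic P p0 P p0 (\<lambda>x. \<mu> (\<eta> x, x)) (\<lambda>_. p0) \<and>
     pointed_homotopic P p0 P p0 (\<lambda>x. \<mu> (x, \<eta> x)) (\<lambda>_. p0) \<and>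
     pointed_homotopic (prod_topology (prod_topology P P) P) ((p0, p0), p0) P p0
       (\<lambda>((x, y), z). \<mu> (\<mu> (x, y), z)) (\<lambda>((x, y), z). \<mu> (x, \<mu> (y, z)))"

text \<open>The homotopies are pointed; the second one forces \<open>\<phi> p0 = q0\<close>, because \<open>\<eta> p0 = p0\<close>.\<close>

definition H_homomorphism ::
  "'a topology \<Rightarrow> 'a \<Rightarrow> ('a \<times> 'a \<Rightarrow> 'a) \<Rightarrow> ('a \<Rightarrow> 'a) \<Rightarrow>
   'b topology \<Rightarrow> 'b \<Rightarrow> ('b \<times> 'b \<Rightarrow> 'b) \<Rightarrow> ('b \<Rightarrow> 'b) \<Rightarrow> ('a \<Rightarrow> 'b) \<Rightarrow> bool" where
  "H_homomorphism P p0 \<mu> \<eta> Q q0 \<mu>2 \<eta>2 \<phi> \<longleftrightarrow>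
     H_group P p0 \<mu> \<eta> \<and> H_group Q q0 \<mu>2 \<eta>2 \<and>
     continuous_map P Q \<phi> \<and>
     pointed_homotopic (prod_topology P P) (p0, p0) Q q0
       (\<lambda>(x, y). \<phi> (\<mu> (x, y))) (\<lambda>(x, y). \<mu>2 (\<phi> x, \<phi> y)) \<and>
     pointed_homotopic P p0 Q q0 (\<lambda>x. \<phi> (\<eta> x)) (\<lambda>x. \<eta>2 (\<phi> x))"

definition sub_H_group ::
  "'a topology \<Rightarrow> 'a \<Rightarrow> ('a \<times> 'a \<Rightarrow> 'a) \<Rightarrow> ('a \<Rightarrow> 'a) \<Rightarrow> 'a set \<Rightarrow> bool" where
  "sub_H_group P p0 \<mu> \<eta> S \<longleftrightarrow>
     S \<subseteq> topspace P \<and> p0 \<in> S \<and>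
     (\<exists>\<mu>' \<eta>'. H_group (subtopology P S) p0 \<mu>' \<eta>' \<and>
        H_homomorphism (subtopology P S) p0 \<mu>' \<eta>' P p0 \<mu> \<eta> (\<lambda>x. x))"

definition saturated_in :: "'a topology \<Rightarrow> 'a set \<Rightarrow> bool" where
  "saturated_in P A \<longleftrightarrow>
     A \<subseteq> topspace P \<and> (\<forall>a\<in>A. Collect (path_component_of P a) \<subseteq> A)"

definition path_mem :: "'a topology \<Rightarrow> 'a \<Rightarrow> 'a set \<Rightarrow> bool" where
  "path_mem P g A \<longleftrightarrow> (\<exists>a\<in>A. path_component_of P g a)"

text \<open>The product \<open>g.g'.g\<^sup>-\<^sup>1\<close> is read as \<open>(g.g').g\<^sup>-\<^sup>1\<close>; homotopy associativity puts the other
  bracketing in the same path component.\<close>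

definition normal_sub_H_group ::
  "'a topology \<Rightarrow> 'a \<Rightarrow> ('a \<times> 'a \<Rightarrow> 'a) \<Rightarrow> ('a \<Rightarrow> 'a) \<Rightarrow> 'a set \<Rightarrow> bool" where
  "normal_sub_H_group P p0 \<mu> \<eta> S \<longleftrightarrow>
     sub_H_group P p0 \<mu> \<eta> S \<and>
     (\<forall>g\<in>topspace P. \<forall>g'\<in>S. path_mem P (\<mu> (\<mu> (g, g'), \<eta> g)) S)"

text \<open>The homotopy here is free: no condition is imposed on its stages.\<close>

definition H_center :: "'a topology \<Rightarrow> ('a \<times> 'a \<Rightarrow> 'a) \<Rightarrow> 'a set" where
  "H_center P \<mu> =
     {g \<in> topspace P. homotopic_with (\<lambda>_. True) P P (\<lambda>x. \<mu> (g, x)) (\<lambda>x. \<mu> (x, g))}"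

end

theory Submission
  imports Defs
begin

text \<open>Write \<open>L g\<close> and \<open>R g\<close> for left and right translation by \<open>g\<close>. Up to free homotopy,
  \<open>L\<close> and \<open>R\<close> depend only on the path component of \<open>g\<close>, \<open>L\<close> is multiplicative, \<open>R\<close> is
  antimultiplicative, and every \<open>L g\<close> commutes with every \<open>R h\<close>. Hence the center is saturated
  and closed under \<open>\<mu>\<close> and \<open>\<eta>\<close>: if \<open>L g \<simeq> R g\<close> then, with \<open>k = \<eta> g\<close>,
  \<open>L k \<simeq> L k \<circ> R g \<circ> R k \<simeq> L k \<circ> L g \<circ> R k \<simeq> R k\<close>.
  A homotopy that starts in a saturated set stays in it, so all structure homotopies restrict
  to the center. Evaluating \<open>L g' \<simeq> R g'\<close> at \<open>g\<close> gives a path from \<open>g . g'\<close> to \<open>g' . g\<close>,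
  hence normality.\<close>

section \<open>Tracks of homotopies and saturated sets\<close>

text \<open>The track \<open>t \<mapsto> h (t, x)\<close> of the point under the homotopy is the
  required path. This turns homotopies between maps into paths between their values.\<close>

lemma homotopic_with_path_component_of:
  assumes "homotopic_with Q X Y f g" and "x \<in> topspace X"
  shows "path_component_of Y (f x) (g x)"
proof -
  obtain h where h: "continuous_map (prod_topology (top_of_set {0..1::real}) X) Y h"
    and h01: "h (0, x) = f x" "h (1, x) = g x"
    using assms(1) unfolding homotopic_with_def by blast
  have "pathin Y (h \<circ> (\<lambda>t. (t, x)))"
    unfolding pathin_def
    by (rule continuous_map_compose[OF _ h]) (simp add: continuous_map_pairwise o_def assms(2))
  then show ?thesis
    unfolding path_component_of_def using h01 by (intro exI) auto
qed

lemma homotopic_with_into_saturated: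
  assumes "homotopic_with Q X Y f g" and S: "saturated_in Y S"
    and f: "\<And>x. x \<in> topspace X \<Longrightarrow> f x \<in> S"
  shows "homotopic_with Q X (subtopology Y S) f g"
proof -
  obtain h where h: "continuous_map (prod_topology (top_of_set {0..1::real}) X) Y h"
    and h01: "\<forall>x. h (0, x) = f x" "\<forall>x. h (1, x) = g x"
    and Q: "\<forall>t\<in>{0..1}. Q (\<lambda>x. h (t, x))"
    using assms(1) unfolding homotopic_with_def by blast
  have "h (t, x) \<in> S" if "t \<in> {0..1}" "x \<in> topspace X" for t x
  proof -
    have "pathin Y (h \<circ> (\<lambda>t. (t, x)))"
      unfolding pathin_def
      by (rule continuous_map_compose[OF _ h]) (simp add: continuous_map_pairwise o_def that)
    \<comment> \<open>Working with the image of the whole track reaches every intermediate time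
      \<open>t\<close> without reparametrizing the path from time 0 to time
      \<open>t\<close>.\<close>
    then have "path_connectedin Y ((h \<circ> (\<lambda>t. (t, x))) ` {0..1})"
      by (rule path_connectedin_path_image)
    moreover have "f x \<in> (h \<circ> (\<lambda>t. (t, x))) ` {0..1}"
      using h01 by (intro image_eqI[where x=0]) auto
    ultimately have "path_component_of Y (f x) (h (t, x))"
      unfolding path_component_of using that by auto
    then show ?thesis
      using S f[OF that(2)] unfolding saturated_in_def by blast
  qed
  then have "continuous_map (prod_topology (top_of_set {0..1}) X) (subtopology Y S) h"
    using h by (auto intro!: continuous_map_into_subtopology)
  then show ?thesis
    unfolding homotopic_with_def using h01 Q by blast
qed

text \<open>Source and target are cut down to different sets because the source may be a product:
  for associativity \<open>A\<close> is a triple product of copies of \<open>S\<close>.\<close>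

lemma pointed_homotopic_restrict_saturated:
  assumes "pointed_homotopic X x0 Y y0 f g" and "saturated_in Y S"
    and "\<And>x. x \<in> topspace X \<Longrightarrow> x \<in> A \<Longrightarrow> f x \<in> S"
  shows "pointed_homotopic (subtopology X A) x0 (subtopology Y S) y0 f g"
  using assms unfolding pointed_homotopic_def
  by (intro homotopic_with_into_saturated homotopic_from_subtopology) auto

context
  fixes P :: "'a topology" and p0 :: 'a
    and \<mu> :: "'a \<times> 'a \<Rightarrow> 'a" and \<eta> :: "'a \<Rightarrow> 'a"
  assumes H: "H_group P p0 \<mu> \<eta>"
begin

declare homotopic_with_trans [trans] path_component_of_trans [trans]

private abbreviation L :: "'a \<Rightarrow> 'a \<Rightarrow> 'a" where "L g \<equiv> \<lambda>x. \<mu> (g, x)"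
private abbreviation R :: "'a \<Rightarrow> 'a \<Rightarrow> 'a" where "R g \<equiv> \<lambda>x. \<mu> (x, g)"
text \<open>Free homotopy is the right relation here: a translation by \<open>g\<close> need not fix
  \<open>p0\<close>.\<close>

private abbreviation hom (infix "\<simeq>" 50) where "f \<simeq> g \<equiv> homotopic_with (\<lambda>_. True) P P f g"

lemma basepoint_in_topspace: "p0 \<in> topspace P"
  and continuous_map_mult: "continuous_map (prod_topology P P) P \<mu>"
  and continuous_map_inverse: "continuous_map P P \<eta>"
  using H by (auto simp: H_group_def)

lemma mult_in_topspace: "g \<in> topspace P \<Longrightarrow> h \<in> topspace P \<Longrightarrow> \<mu> (g, h) \<in> topspace P"
  using continuous_map_mult by (fastforce simp: continuous_map_def)

lemma inverse_in_topspace: "g \<in> topspace P \<Longrightarrow> \<eta> g \<in> topspace P"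
  using continuous_map_inverse by (fastforce simp: continuous_map_def)

lemma continuous_map_mult_compose:
  assumes "continuous_map X P f" "continuous_map X P g"
  shows "continuous_map X P (\<lambda>x. \<mu> (f x, g x))"
proof -
  have "continuous_map X P (\<mu> \<circ> (\<lambda>x. (f x, g x)))"
    by (rule continuous_map_compose[OF _ continuous_map_mult]) (simp add: continuous_map_pairwise o_def assms)
  then show ?thesis by (simp add: o_def)
qed

lemma continuous_map_left_translation: "g \<in> topspace P \<Longrightarrow> continuous_map P P (L g)"
  and continuous_map_right_translation: "g \<in> topspace P \<Longrightarrow> continuous_map P P (R g)"
  by (auto intro!: continuous_map_mult_compose)

section \<open>Translations up to free homotopy\<close>

text \<open>Pull the associativity homotopy back along \<open>x \<mapsto> ((a x, b x), c x)\<close>.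
  This map need not be pointed, so only a free homotopy survives.\<close>

lemma mult_assoc_homotopic:
  assumes "continuous_map X P a" "continuous_map X P b" "continuous_map X P c"
  shows "homotopic_with (\<lambda>_. True) X P (\<lambda>x. \<mu> (\<mu> (a x, b x), c x)) (\<lambda>x. \<mu> (a x, \<mu> (b x, c x)))"
proof -
  have "homotopic_with (\<lambda>h. h ((p0, p0), p0) = p0) (prod_topology (prod_topology P P) P) P
       (\<lambda>((x, y), z). \<mu> (\<mu> (x, y), z)) (\<lambda>((x, y), z). \<mu> (x, \<mu> (y, z)))"
    using H by (simp add: H_group_def pointed_homotopic_def)
  moreover have "continuous_map X (prod_topology (prod_topology P P) P) (\<lambda>x. ((a x, b x), c x))"
    by (simp add: continuous_map_pairwise o_def assms)
  ultimately have "homotopic_with (\<lambda>_. True) X P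
      ((\<lambda>((x, y), z). \<mu> (\<mu> (x, y), z)) \<circ> (\<lambda>x. ((a x, b x), c x)))
      ((\<lambda>((x, y), z). \<mu> (x, \<mu> (y, z))) \<circ> (\<lambda>x. ((a x, b x), c x)))"
    by (rule homotopic_with_compose_continuous_map_right) simp
  then show ?thesis by (simp add: o_def)
qed

text \<open>This and the next two laws are associativity with two slots held constant and the
  identity in the middle, last and first slot respectively.\<close>

lemma translation_commute:
  assumes "g \<in> topspace P" "h \<in> topspace P"
  shows "R h \<circ> L g \<simeq> L g \<circ> R h"
  using mult_assoc_homotopic[of P "\<lambda>_. g" "\<lambda>x. x" "\<lambda>_. h"] assms by (simp add: o_def)

lemma left_translation_mult:
  assumes "g \<in> topspace P" "h \<in> topspace P"
  shows "L (\<mu> (g, h)) \<simeq> L g \<circ> L h"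
  using mult_assoc_homotopic[of P "\<lambda>_. g" "\<lambda>_. h" "\<lambda>x. x"] assms by (simp add: o_def)

lemma right_translation_mult:
  assumes "g \<in> topspace P" "h \<in> topspace P"
  shows "R h \<circ> R g \<simeq> R (\<mu> (g, h))"
  using mult_assoc_homotopic[of P "\<lambda>x. x" "\<lambda>_. g" "\<lambda>_. h"] assms by (simp add: o_def)

lemma left_translation_basepoint: "L p0 \<simeq> (\<lambda>x. x)"
  and right_translation_basepoint: "R p0 \<simeq> (\<lambda>x. x)"
  using H by (auto simp: H_group_def pointed_homotopic_def intro: homotopic_with_mono)

text \<open>Take the product of the two homotopies, precompose with the diagonal of \<open>X\<close>
  and postcompose with \<open>\<mu>\<close>.\<close>

lemma mult_homotopic:
  assumes "homotopic_with (\<lambda>_. True) X P f f'" "homotopic_with (\<lambda>_. True) X P g g'"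
  shows "homotopic_with (\<lambda>_. True) X P (\<lambda>x. \<mu> (f x, g x)) (\<lambda>x. \<mu> (f' x, g' x))"
proof -
  have "homotopic_with (\<lambda>_. True) (prod_topology X X) (prod_topology P P)
      (\<lambda>z. (f (fst z), g (snd z))) (\<lambda>z. (f' (fst z), g' (snd z)))"
    by (rule homotopic_with_prod_topology[OF assms]) simp
  moreover have "continuous_map X (prod_topology X X) (\<lambda>x. (x, x))"
    by (simp add: continuous_map_pairwise o_def)
  ultimately have "homotopic_with (\<lambda>_. True) X (prod_topology P P)
      ((\<lambda>z. (f (fst z), g (snd z))) \<circ> (\<lambda>x. (x, x))) ((\<lambda>z. (f' (fst z), g' (snd z))) \<circ> (\<lambda>x. (x, x)))"
    by (rule homotopic_with_compose_continuous_map_right) simp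
  then have "homotopic_with (\<lambda>_. True) X P
      (\<mu> \<circ> ((\<lambda>z. (f (fst z), g (snd z))) \<circ> (\<lambda>x. (x, x))))
      (\<mu> \<circ> ((\<lambda>z. (f' (fst z), g' (snd z))) \<circ> (\<lambda>x. (x, x))))"
    by (rule homotopic_with_compose_continuous_map_left[OF _ continuous_map_mult]) simp
  then show ?thesis by (simp add: o_def)
qed

text \<open>A path from \<open>g\<close> to \<open>h\<close> is a homotopy between the constant maps
  at \<open>g\<close> and \<open>h\<close>; multiply it by the constant homotopy of the
  identity.\<close>

lemma left_translation_path: "path_component_of P g h \<Longrightarrow> L g \<simeq> L h"
  and right_translation_path: "path_component_of P g h \<Longrightarrow> R g \<simeq> R h"
  by (auto intro!: mult_homotopic simp: homotopic_constant_maps)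

lemma mult_path:
  assumes "path_component_of P g g'" "path_component_of P h h'"
  shows "path_component_of P (\<mu> (g, h)) (\<mu> (g', h'))"
proof -
  have "homotopic_with (\<lambda>_. True) P P (\<lambda>_. \<mu> (g, h)) (\<lambda>_. \<mu> (g', h'))"
    using assms by (intro mult_homotopic) (simp_all add: homotopic_constant_maps)
  \<comment> \<open>A homotopy between constant maps yields a path only over a nonempty space;
    \<open>p0\<close> supplies the point at which to evaluate.\<close>
  then show ?thesis
    using basepoint_in_topspace homotopic_with_path_component_of by fastforce
qed

lemma mult_assoc_path:
  assumes "a \<in> topspace P" "b \<in> topspace P" "c \<in> topspace P"
  shows "path_component_of P (\<mu> (\<mu> (a, b), c)) (\<mu> (a, \<mu> (b, c)))"
  using homotopic_with_path_component_of[OF mult_assoc_homotopic[of P "\<lambda>_. a" "\<lambda>_. b" "\<lambda>_. c"]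
      basepoint_in_topspace] assms by simp

lemma inverse_mult_path: "g \<in> topspace P \<Longrightarrow> path_component_of P (\<mu> (\<eta> g, g)) p0"
  and mult_inverse_path: "g \<in> topspace P \<Longrightarrow> path_component_of P (\<mu> (g, \<eta> g)) p0"
  and mult_basepoint_path: "g \<in> topspace P \<Longrightarrow> path_component_of P (\<mu> (g, p0)) g"
  using H by (auto simp: H_group_def pointed_homotopic_def dest: homotopic_with_path_component_of)

section \<open>Closure properties of the center\<close>

lemma saturated_H_center: "saturated_in P (H_center P \<mu>)"
  unfolding saturated_in_def
proof (intro conjI ballI subsetI)
  fix g h assume g: "g \<in> H_center P \<mu>" and "h \<in> Collect (path_component_of P g)"
  then have gh: "path_component_of P g h" by simp
  have "L h \<simeq> L g"
    using left_translation_path[OF gh] by (rule homotopic_with_symD)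
  also have "L g \<simeq> R g" using g by (simp add: H_center_def)
  also have "R g \<simeq> R h" by (rule right_translation_path[OF gh])
  finally show "h \<in> H_center P \<mu>"
    using path_component_in_topspace[OF gh] by (simp add: H_center_def)
qed (auto simp: H_center_def)

lemma basepoint_in_H_center: "p0 \<in> H_center P \<mu>"
  unfolding H_center_def
  using basepoint_in_topspace left_translation_basepoint right_translation_basepoint
  by (auto intro: homotopic_with_trans homotopic_with_symD)

lemma mult_in_H_center:
  assumes "g \<in> H_center P \<mu>" "h \<in> H_center P \<mu>"
  shows "\<mu> (g, h) \<in> H_center P \<mu>"
proof -
  have g: "g \<in> topspace P" "L g \<simeq> R g" and h: "h \<in> topspace P" "L h \<simeq> R h"
    using assms by (auto simp: H_center_def)
  have "L (\<mu> (g, h)) \<simeq> L g \<circ> L h" by (rule left_translation_mult[OF g(1) h(1)])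
  also have "L g \<circ> L h \<simeq> L g \<circ> R h"
    by (rule homotopic_compose[OF h(2)]) (simp add: continuous_map_left_translation g)
  \<comment> \<open>The exchange brings \<open>L g\<close> to the inside, so that replacing it by
    \<open>R g\<close> leaves the right translations in the order that antimultiplicativity
    expects.\<close>
  also have "L g \<circ> R h \<simeq> R h \<circ> L g"
    using translation_commute[OF g(1) h(1)] by (rule homotopic_with_symD)
  also have "R h \<circ> L g \<simeq> R h \<circ> R g"
    by (rule homotopic_compose[OF g(2)]) (simp add: continuous_map_right_translation h)
  also have "R h \<circ> R g \<simeq> R (\<mu> (g, h))" by (rule right_translation_mult[OF g(1) h(1)])
  finally show ?thesis
    using mult_in_topspace[OF g(1) h(1)] by (simp add: H_center_def)
qed

lemma inverse_in_H_center:
  assumes "g \<in> H_center P \<mu>"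
  shows "\<eta> g \<in> H_center P \<mu>"
proof -
  define k where "k = \<eta> g"
  have g: "g \<in> topspace P" "L g \<simeq> R g"
    using assms by (auto simp: H_center_def)
  have k: "k \<in> topspace P" unfolding k_def by (rule inverse_in_topspace[OF g(1)])
  have kg: "path_component_of P (\<mu> (k, g)) p0"
    unfolding k_def by (rule inverse_mult_path[OF g(1)])
  have Lk: "L k \<simeq> L k" and Rk: "R k \<simeq> R k"
    by (simp_all add: continuous_map_left_translation continuous_map_right_translation k)
  \<comment> \<open>Since \<open>R\<close> reverses products, this composite and
    \<open>L k \<circ> L g\<close> below are both translations by \<open>\<mu> (k, g)\<close>; the
    single path \<open>kg\<close> to \<open>p0\<close> makes both homotopic to the identity.\<close>
  have "R g \<circ> R k \<simeq> R (\<mu> (k, g))" by (rule right_translation_mult[OF k g(1)])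
  also have "R (\<mu> (k, g)) \<simeq> R p0" by (rule right_translation_path[OF kg])
  also have "R p0 \<simeq> (\<lambda>x. x)" by (rule right_translation_basepoint)
  finally have Rgk: "R g \<circ> R k \<simeq> (\<lambda>x. x)" .
  have "L k \<circ> L g \<simeq> L (\<mu> (k, g))"
    using left_translation_mult[OF k g(1)] by (rule homotopic_with_symD)
  also have "L (\<mu> (k, g)) \<simeq> L p0" by (rule left_translation_path[OF kg])
  also have "L p0 \<simeq> (\<lambda>x. x)" by (rule left_translation_basepoint)
  finally have Lkg: "L k \<circ> L g \<simeq> (\<lambda>x. x)" .
  have "L k \<simeq> L k \<circ> (R g \<circ> R k)"
    using homotopic_compose[OF homotopic_with_symD[OF Rgk] Lk] by (simp add: o_def)
  also have "L k \<circ> (R g \<circ> R k) \<simeq> L k \<circ> (L g \<circ> R k)"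
    by (rule homotopic_compose[OF homotopic_compose[OF Rk homotopic_with_symD[OF g(2)]] Lk])
  also have "L k \<circ> (L g \<circ> R k) \<simeq> R k"
    using homotopic_compose[OF Rk Lkg] by (simp add: o_def)
  finally show ?thesis
    using k unfolding k_def by (simp add: H_center_def)
qed

section \<open>The H-group structure on the center, and normality\<close>

lemma sub_H_group_H_center: "sub_H_group P p0 \<mu> \<eta> (H_center P \<mu>)"
proof -
  let ?Z = "H_center P \<mu>"
  let ?S = "subtopology P ?Z"
  have Z: "?Z \<subseteq> topspace P" by (auto simp: H_center_def)
  \<comment> \<open>Products of subspaces are rewritten as subspaces of products, the form in which
    maps and homotopies on \<open>P\<close> can be restricted.\<close>
  have prod: "prod_topology ?S ?S = subtopology (prod_topology P P) (?Z \<times> ?Z)"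
    "prod_topology (subtopology (prod_topology P P) (?Z \<times> ?Z)) ?S
      = subtopology (prod_topology (prod_topology P P) P) ((?Z \<times> ?Z) \<times> ?Z)"
    by (simp_all add: subtopology_Times)
  note closed = basepoint_in_H_center mult_in_H_center inverse_in_H_center
  note restrict = pointed_homotopic_restrict_saturated[OF _ saturated_H_center]
  have cont: "continuous_map (prod_topology ?S ?S) ?S \<mu>" "continuous_map ?S ?S \<eta>"
    unfolding prod
    by (rule continuous_map_into_subtopology[OF continuous_map_from_subtopology],
        use continuous_map_mult continuous_map_inverse closed in auto)+
  have grp: "H_group ?S p0 \<mu> \<eta>"
    unfolding H_group_def
  proof (intro conjI)
    show "pointed_homotopic (prod_topology (prod_topology ?S ?S) ?S) ((p0, p0), p0) ?S p0
       (\<lambda>((x, y), z). \<mu> (\<mu> (x, y), z)) (\<lambda>((x, y), z). \<mu> (x, \<mu> (y, z)))"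
      unfolding prod
      by (rule restrict) (use H closed in \<open>auto simp: H_group_def\<close>)
  qed (use H closed cont in \<open>auto simp: H_group_def intro!: restrict\<close>)
  \<comment> \<open>The center carries the restrictions of \<open>\<mu>\<close> and
    \<open>\<eta>\<close> themselves, so the inclusion commutes with them strictly and constant
    homotopies suffice.\<close>
  have "H_homomorphism ?S p0 \<mu> \<eta> P p0 \<mu> \<eta> (\<lambda>x. x)"
    unfolding H_homomorphism_def pointed_homotopic_def
    using grp H cont by (auto simp: H_group_def case_prod_unfold continuous_map_in_subtopology)
  then show ?thesis
    unfolding sub_H_group_def using Z grp basepoint_in_H_center by blast
qed

text \<open>Once \<open>g\<close> and \<open>z\<close> are swapped, associativity brings
  \<open>g\<close> next to \<open>\<eta> g\<close>, and their product contracts to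
  \<open>p0\<close>. The witness for \<open>path_mem\<close> is thus \<open>z\<close>
  itself.\<close>

lemma conjugate_path_H_center:
  assumes g: "g \<in> topspace P" and "z \<in> H_center P \<mu>"
  shows "path_component_of P (\<mu> (\<mu> (g, z), \<eta> g)) z"
proof -
  have z: "z \<in> topspace P" "L z \<simeq> R z" using assms by (auto simp: H_center_def)
  have "path_component_of P (\<mu> (g, z)) (\<mu> (z, g))"
    using homotopic_with_path_component_of[OF z(2) g] by (rule path_component_of_sym)
  then have "path_component_of P (\<mu> (\<mu> (g, z), \<eta> g)) (\<mu> (\<mu> (z, g), \<eta> g))"
    by (rule mult_path) (simp add: path_component_of_refl inverse_in_topspace g)
  also have "path_component_of P (\<mu> (\<mu> (z, g), \<eta> g)) (\<mu> (z, \<mu> (g, \<eta> g)))"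
    by (rule mult_assoc_path[OF z(1) g inverse_in_topspace[OF g]])
  also have "path_component_of P (\<mu> (z, \<mu> (g, \<eta> g))) (\<mu> (z, p0))"
    using z g by (intro mult_path mult_inverse_path) (simp_all add: path_component_of_refl)
  also have "path_component_of P (\<mu> (z, p0)) z" by (rule mult_basepoint_path[OF z(1)])
  finally show ?thesis .
qed

end

theorem theorem4p15:
  fixes P :: "'a topology" and p0 :: 'a
    and \<mu> :: "'a \<times> 'a \<Rightarrow> 'a" and \<eta> :: "'a \<Rightarrow> 'a"
  assumes "H_group P p0 \<mu> \<eta>"
  shows "normal_sub_H_group P p0 \<mu> \<eta> (H_center P \<mu>) \<and> saturated_in P (H_center P \<mu>)"
  using sub_H_group_H_center[OF assms] saturated_H_center[OF assms] conjugate_path_H_center[OF assms]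
  unfolding normal_sub_H_group_def path_mem_def by blast

end
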